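(* For every distribution of $\boldsymbol c$ such that $\boldsymbol c\in L^1(\Omega,\mathcal A,\mathbb P;\mathbb R^m)$ is integrable and $\boldsymbol c\in-\operatorname{Cone}(A^\top)$ almost surely, the expected cost-to-go function $V$ is affine on each cell of the chamber complex $\mathcal C(P,\pi)$.
   Context: Two-stage setting: $(\Omega,\mathcal A,\mathbb P)$ is a probability space, $A\in\mathbb R^{q\times m}$, $B\in\mathbb R^{q\times n}$, $b\in\mathbb R^q$ are deterministic, $\boldsymbol c$ is a random vector in $\mathbb R^m$. For $x\in\mathbb R^n$, $c\in\mathbb R^m$, $\hat V(x,c):=\min_{y\in\mathbb R^m}\{c^\top y: Ay+Bx\le b\}$ and $V(x):=\mathbb E[\hat V(x,\boldsymbol c)]$. $P:=\{(x,y)\in\mathbb R^n\times\mathbb R^m: Ay+Bx\le b\}$ and $\pi(x,y):=x$. $\operatorname{Cone}(A^\top):=A^\top\mathbb R^q_+$. Chamber complex: with $\mathcal F(P)$ the set of non-empty faces of $P$ (including $P$), for $x\in\pi(P)$ set $\sigma_{P,\pi}(x):=\bigcap_{F\in\mathcal F(P),\,x\in\pi(F)}\pi(F)$, and $\mathcal C(P,\pi):=\{\sigma_{P,\pi}(x):x\in\pi(P)\}$; it is a polyhedral complex with support $\pi(P)$, and it does not depend on the distribution of $\boldsymbol c$. *)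

theory Defs
  imports "HOL-Probability.Probability"
begin

(* Vectors in real^'k carry the componentwise order, so "A *v y + B *v x \<le> b" is the
   system of q scalar inequalities. *)
definition feasible_y :: "real^'m^'q \<Rightarrow> real^'n^'q \<Rightarrow> real^'q \<Rightarrow> real^'n \<Rightarrow> (real^'m) set" where
  "feasible_y A B b x = {y. A *v y + B *v x \<le> b}"

(* Minimum of a linear cost over a set: \<infinity> if the problem is infeasible, -\<infinity> if it is feasible
   without a minimizer (for a polyhedron this happens only when the cost is unbounded below). *)
definition lin_min :: "'a::euclidean_space \<Rightarrow> 'a set \<Rightarrow> ereal" where
  "lin_min c S =
     (if S = {} then \<infinity>
      else if \<exists>y. is_arg_min (\<lambda>y. c \<bullet> y) (\<lambda>y. y \<in> S) y
           then ereal (c \<bullet> arg_min (\<lambda>y. c \<bullet> y) (\<lambda>y. y \<in> S))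
           else -\<infinity>)"

lemma lin_min_eq:
  assumes "y \<in> S" "\<And>z. z \<in> S \<Longrightarrow> c \<bullet> y \<le> c \<bullet> z"
  shows "lin_min c S = ereal (c \<bullet> y)"
proof -
  have y: "is_arg_min (\<lambda>y. c \<bullet> y) (\<lambda>y. y \<in> S) y"
    using assms by (auto simp: is_arg_min_linorder)
  then have "is_arg_min (\<lambda>y. c \<bullet> y) (\<lambda>y. y \<in> S) (arg_min (\<lambda>y. c \<bullet> y) (\<lambda>y. y \<in> S))"
    unfolding arg_min_def by (rule someI)
  with assms have "c \<bullet> arg_min (\<lambda>y. c \<bullet> y) (\<lambda>y. y \<in> S) = c \<bullet> y"
    by (auto simp: is_arg_min_linorder intro: antisym)
  with y assms(1) show ?thesis
    unfolding lin_min_def by auto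
qed

definition Vhat :: "real^'m^'q \<Rightarrow> real^'n^'q \<Rightarrow> real^'q \<Rightarrow> real^'n \<Rightarrow> real^'m \<Rightarrow> ereal" where
  "Vhat A B b x c = lin_min c (feasible_y A B b x)"

(* e2ennreal truncates negative values to 0, so the two integrals are those of the positive and
   the negative part; as \<infinity> - \<infinity> = \<infinity> in ereal, a finite value means that both are finite. *)
definition ereal_expectation :: "'w measure \<Rightarrow> ('w \<Rightarrow> ereal) \<Rightarrow> ereal" where
  "ereal_expectation M f =
     enn2ereal (\<integral>\<^sup>+ w. e2ennreal (f w) \<partial>M) - enn2ereal (\<integral>\<^sup>+ w. e2ennreal (- f w) \<partial>M)"

lemma ereal_expectation_eq_integral:
  assumes "integrable M g"
  shows "ereal_expectation M (\<lambda>w. ereal (g w)) = ereal (\<integral>w. g w \<partial>M)"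
proof -
  have e: "e2ennreal (ereal r) = ennreal r" for r
    by (simp add: ennreal_def e2ennreal_def)
  have fin: "(\<integral>\<^sup>+ w. ennreal (g w) \<partial>M) \<noteq> \<infinity>" "(\<integral>\<^sup>+ w. ennreal (- g w) \<partial>M) \<noteq> \<infinity>"
    using assms by (auto simp: real_integrable_def)
  then obtain p n where "p \<ge> 0" "n \<ge> 0" "(\<integral>\<^sup>+ w. ennreal (g w) \<partial>M) = ennreal p"
      "(\<integral>\<^sup>+ w. ennreal (- g w) \<partial>M) = ennreal n"
    by (metis ennreal_cases infinity_ennreal_def)
  then show ?thesis
    unfolding ereal_expectation_def real_lebesgue_integral_def[OF assms] by (simp add: e)
qed

definition V :: "'w measure \<Rightarrow> ('w \<Rightarrow> real^'m) \<Rightarrow> real^'m^'q \<Rightarrow> real^'n^'q \<Rightarrow> real^'q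
    \<Rightarrow> real^'n \<Rightarrow> ereal" where
  "V M c A B b x = ereal_expectation M (\<lambda>w. Vhat A B b x (c w))"

definition Pol :: "real^'m^'q \<Rightarrow> real^'n^'q \<Rightarrow> real^'q \<Rightarrow> ((real^'n) \<times> (real^'m)) set" where
  "Pol A B b = {(x, y). A *v y + B *v x \<le> b}"

definition Cone :: "real^'k^'l \<Rightarrow> (real^'l) set" where
  "Cone D = {D *v u |u. 0 \<le> u}"

definition chamber :: "'a::euclidean_space set \<Rightarrow> ('a \<Rightarrow> 'b) \<Rightarrow> 'b \<Rightarrow> 'b set" where
  "chamber P p x = \<Inter> {p ` F |F. F face_of P \<and> F \<noteq> {} \<and> x \<in> p ` F}"

definition chamber_complex :: "'a::euclidean_space set \<Rightarrow> ('a \<Rightarrow> 'b) \<Rightarrow> 'b set set" where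
  "chamber_complex P p = chamber P p ` (p ` P)"

(* In particular f is finite on S. *)
definition affine_fun_on :: "'a::euclidean_space set \<Rightarrow> ('a \<Rightarrow> ereal) \<Rightarrow> bool" where
  "affine_fun_on S f \<longleftrightarrow> (\<exists>a \<beta>. \<forall>x\<in>S. f x = ereal (a \<bullet> x + \<beta>))"

end

theory Submission
  imports Defs
begin

text \<open>
  Fix a chamber \<open>\<sigma>(x0)\<close> and a cost vector \<open>c\<close> that is bounded below on the fibres of \<open>P\<close>. Take a
  minimiser \<open>y0\<close> over \<open>x0\<close> and let \<open>I\<close> be the set of constraints that are tight at \<open>(x0, y0)\<close>. The
  points of \<open>P\<close> at which all of \<open>I\<close> is tight form a face \<open>F\<close>, and \<open>x0 \<in> \<pi>(F)\<close>, so the whole chamber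
  lies in \<open>\<pi>(F)\<close>: above every \<open>x\<close> of the chamber there is some \<open>(x, y) \<in> F\<close>. This \<open>y\<close> is a minimiser
  over \<open>x\<close>, because a feasible direction that improves on \<open>y\<close> would, after scaling, also improve
  on \<open>y0\<close>. Moreover no direction that keeps \<open>I\<close> tight changes the cost, so \<open>c\<close> is a linear
  combination of the rows of \<open>A\<close> in \<open>I\<close>, and on \<open>F\<close> the cost \<open>c \<bullet> y\<close> is an affine function of \<open>x\<close>.
  Hence \<open>Vhat\<close> is affine in \<open>x\<close> on the chamber, and the chamber does not depend on \<open>c\<close>
  (\<open>Vhat_affine_on_chamber\<close>).

  It remains to integrate over \<open>c\<close>. The slope chosen for each \<open>c\<close> need not be measurable, so
  affinity is transferred through values alone: the value at any point of the chamber is a fixed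
  linear combination of the values at finitely many points of it (\<open>integral_affine_on\<close>). The values
  are integrable because a polyhedron contains a finite set that meets the minimisers of every
  linear cost bounded below on it (\<open>finite_minimizing_set\<close>), so that \<open>Vhat\<close> at a given \<open>x\<close> is a
  minimum of finitely many linear functions of \<open>c\<close>. The same lemma provides the minimiser \<open>y0\<close>.
  Boundedness below is weak duality for costs in \<open>- Cone (transpose A)\<close>.
\<close>

section \<open>Linear costs on a polyhedron\<close>

definition tight_rows :: "real^'m^'q \<Rightarrow> real^'q \<Rightarrow> real^'m \<Rightarrow> 'q set" where
  "tight_rows A d y = {i. (A *v y) $ i = d $ i}"

lemma matrix_vector_mult_uminus: "(A :: real^'m^'q) *v (- z) = - (A *v z)"
  using matrix_vector_mult_scaleR[of A "-1" z] by simp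

lemma small_step_feasible:
  fixes A :: "real^'m^'q"
  assumes y: "A *v y \<le> d" and z: "\<And>i. i \<in> tight_rows A d y \<Longrightarrow> (A *v z) $ i \<le> 0"
  shows "\<exists>t>0. A *v (y + t *\<^sub>R z) \<le> d"
proof -
  have "\<forall>\<^sub>F t in at_right 0. (A *v y) $ i + t * (A *v z) $ i \<le> d $ i" for i
  proof (cases "i \<in> tight_rows A d y")
    case True
    have "\<forall>\<^sub>F t in at_right (0::real). t > 0"
      by (simp add: eventually_at_right_less)
    then show ?thesis
      by (rule eventually_mono) (use z[OF True] True in \<open>auto simp: tight_rows_def mult_le_0_iff\<close>)
  next
    case False
    then have "(A *v y) $ i < d $ i"
      using y by (auto simp: tight_rows_def less_eq_vec_def less_le)
    moreover have "((\<lambda>t. (A *v y) $ i + t * (A *v z) $ i) \<longlongrightarrow> (A *v y) $ i + 0 * (A *v z) $ i)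
        (at_right 0)"
      by (intro tendsto_intros)
    ultimately have "\<forall>\<^sub>F t in at_right 0. (A *v y) $ i + t * (A *v z) $ i < d $ i"
      by (intro order_tendstoD) auto
    then show ?thesis
      by (rule eventually_mono) auto
  qed
  then have "\<forall>\<^sub>F t in at_right 0. \<forall>i. (A *v y) $ i + t * (A *v z) $ i \<le> d $ i"
    by (rule eventually_all_finite)
  then have "\<forall>\<^sub>F t in at_right 0. t > 0 \<and> (\<forall>i. (A *v y) $ i + t * (A *v z) $ i \<le> d $ i)"
    by (intro eventually_conj) (simp_all add: eventually_at_right_less)
  then obtain t where "t > 0" "\<forall>i. (A *v y) $ i + t * (A *v z) $ i \<le> d $ i"
    using eventually_happens'[OF trivial_limit_at_right_real] by blast
  then show ?thesis
    by (auto simp: less_eq_vec_def matrix_vector_right_distrib matrix_vector_mult_scaleR)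
qed

lemma minimizer_no_descent:
  fixes A :: "real^'m^'q"
  assumes y: "A *v y \<le> d" and min: "\<And>v. A *v v \<le> d \<Longrightarrow> c \<bullet> y \<le> c \<bullet> v"
    and z: "\<And>i. i \<in> tight_rows A d y \<Longrightarrow> (A *v z) $ i \<le> 0"
  shows "0 \<le> c \<bullet> z"
proof -
  obtain t where "t > 0" "A *v (y + t *\<^sub>R z) \<le> d"
    using small_step_feasible[OF y z] by blast
  with min[of "y + t *\<^sub>R z"] show ?thesis
    by (simp add: inner_add_right zero_le_mult_iff)
qed

text \<open>
  Moving along a direction of descent must hit a new constraint, since otherwise the cost would
  be unbounded below; the constraints that were tight stay tight because the direction lies in
  their kernel.
\<close>

lemma descent_enlarges_tight_rows:
  fixes A :: "real^'m^'q"
  assumes y: "A *v y \<le> d" and bdd: "\<And>v. A *v v \<le> d \<Longrightarrow> k \<le> c \<bullet> v"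
    and z: "\<And>i. i \<in> tight_rows A d y \<Longrightarrow> (A *v z) $ i = 0" and neg: "c \<bullet> z < 0"
  shows "\<exists>v. A *v v \<le> d \<and> c \<bullet> v \<le> c \<bullet> y \<and> tight_rows A d y \<subset> tight_rows A d v"
proof -
  define J where "J = {i. (A *v z) $ i > 0}"
  define r where "r i = (d $ i - (A *v y) $ i) / (A *v z) $ i" for i
  have move: "(A *v (y + t *\<^sub>R z)) $ i = (A *v y) $ i + t * (A *v z) $ i" for t i
    by (simp add: matrix_vector_right_distrib matrix_vector_mult_scaleR)
  have y': "(A *v y) $ i \<le> d $ i" for i
    using y by (auto simp: less_eq_vec_def)
  have "J \<noteq> {}"
  proof
    assume "J = {}"
    then have le: "(A *v z) $ i \<le> 0" for i
      by (auto simp: J_def not_less)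
    define t where "t = (\<bar>c \<bullet> y - k\<bar> + 1) / (- (c \<bullet> z))"
    have "t \<ge> 0" and t: "t * (c \<bullet> z) = - (\<bar>c \<bullet> y - k\<bar> + 1)"
      using neg by (auto simp: t_def field_simps)
    have "(A *v (y + t *\<^sub>R z)) $ i \<le> d $ i" for i
      unfolding move using y'[of i] mult_nonneg_nonpos[OF \<open>t \<ge> 0\<close> le[of i]] by linarith
    then have "k \<le> c \<bullet> (y + t *\<^sub>R z)"
      by (intro bdd) (simp add: less_eq_vec_def)
    with t show False
      by (simp add: inner_add_right)
  qed
  define t where "t = Min (r ` J)"
  have "t \<in> r ` J"
    unfolding t_def using \<open>J \<noteq> {}\<close> by (intro Min_in) auto
  then obtain j where j: "j \<in> J" "t = r j"
    by auto
  have t_le: "t \<le> r i" if "i \<in> J" for i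
    unfolding t_def using that by (intro Min_le) auto
  have "t \<ge> 0"
    using j y'[of j] by (auto simp: r_def J_def)
  have "(A *v (y + t *\<^sub>R z)) $ i \<le> d $ i" for i
  proof (cases "i \<in> J")
    case True
    with t_le[OF True] show ?thesis
      unfolding move by (simp add: r_def J_def pos_le_divide_eq)
  next
    case False
    then have "t * (A *v z) $ i \<le> 0"
      using \<open>t \<ge> 0\<close> by (auto simp: J_def not_less mult_nonneg_nonpos)
    with y'[of i] show ?thesis
      unfolding move by linarith
  qed
  moreover have "c \<bullet> (y + t *\<^sub>R z) \<le> c \<bullet> y"
    using neg \<open>t \<ge> 0\<close> by (simp add: inner_add_right mult_nonneg_nonpos)
  moreover have "tight_rows A d y \<subseteq> tight_rows A d (y + t *\<^sub>R z)"
    using z by (auto simp: tight_rows_def move)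
  moreover have "j \<in> tight_rows A d (y + t *\<^sub>R z)"
    using j by (simp add: tight_rows_def move r_def J_def)
  moreover have "j \<notin> tight_rows A d y"
    using j z[of j] by (auto simp: J_def)
  ultimately show ?thesis
    by (intro exI[of _ "y + t *\<^sub>R z"]) (auto simp: less_eq_vec_def)
qed

lemma descent_to_constant_cost:
  fixes A :: "real^'m^'q"
  assumes "A *v y \<le> d" and bdd: "\<And>v. A *v v \<le> d \<Longrightarrow> k \<le> c \<bullet> v"
  shows "\<exists>v. A *v v \<le> d \<and> c \<bullet> v \<le> c \<bullet> y \<and>
           (\<forall>z. (\<forall>i\<in>tight_rows A d v. (A *v z) $ i = 0) \<longrightarrow> c \<bullet> z = 0)"
  using assms(1)
proof (induction y rule: measure_induct_rule[of "\<lambda>y. card (- tight_rows A d y)"])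
  case (less y)
  show ?case
  proof (cases "\<forall>z. (\<forall>i\<in>tight_rows A d y. (A *v z) $ i = 0) \<longrightarrow> c \<bullet> z = 0")
    case True
    with less.prems show ?thesis
      by blast
  next
    case False
    then obtain z where z: "\<forall>i\<in>tight_rows A d y. (A *v z) $ i = 0" "c \<bullet> z \<noteq> 0"
      by blast
    \<comment> \<open>The condition on \<open>z\<close> is symmetric, so its sign may be chosen to make the cost decrease.\<close>
    define z' where "z' = (if c \<bullet> z < 0 then z else - z)"
    have z': "\<forall>i\<in>tight_rows A d y. (A *v z') $ i = 0" "c \<bullet> z' < 0"
      using z by (auto simp: z'_def matrix_vector_mult_uminus)
    obtain v where v: "A *v v \<le> d" "c \<bullet> v \<le> c \<bullet> y" "tight_rows A d y \<subset> tight_rows A d v"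
      using descent_enlarges_tight_rows[OF less.prems bdd] z' by blast
    then have "card (- tight_rows A d v) < card (- tight_rows A d y)"
      by (intro psubset_card_mono) auto
    from less.IH[OF this v(1)] v(2) show ?thesis
      by (meson order_trans)
  qed
qed

text \<open>
  One point is chosen for each set of constraints that occurs as a tight set. Every feasible
  point can be improved to one whose tight set determines the cost, and then the point chosen for
  that tight set does as well. The finite set serves all costs at once.
\<close>

lemma finite_minimizing_set:
  fixes A :: "real^'m^'q"
  obtains Y where "finite Y" "\<And>v. v \<in> Y \<Longrightarrow> A *v v \<le> d"
    "\<And>c k y. (\<And>v. A *v v \<le> d \<Longrightarrow> k \<le> c \<bullet> v) \<Longrightarrow> A *v y \<le> d \<Longrightarrow> \<exists>v\<in>Y. c \<bullet> v \<le> c \<bullet> y"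
proof -
  define pick where "pick I = (SOME v. A *v v \<le> d \<and> tight_rows A d v = I)" for I
  have pick: "A *v pick (tight_rows A d y) \<le> d \<and> tight_rows A d (pick (tight_rows A d y)) = tight_rows A d y"
    if "A *v y \<le> d" for y
    unfolding pick_def by (rule someI[of _ y]) (use that in simp)
  define Y where "Y = pick ` tight_rows A d ` {y. A *v y \<le> d}"
  show thesis
  proof
    show "finite Y"
      unfolding Y_def by (rule finite_imageI, rule finite)
    show "A *v v \<le> d" if "v \<in> Y" for v
      using that pick by (auto simp: Y_def)
    fix c y :: "real^'m" and k
    assume bdd: "\<And>v. A *v v \<le> d \<Longrightarrow> k \<le> c \<bullet> v" and y: "A *v y \<le> d"
    obtain v where v: "A *v v \<le> d" "c \<bullet> v \<le> c \<bullet> y"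
      "\<And>z. \<forall>i\<in>tight_rows A d v. (A *v z) $ i = 0 \<Longrightarrow> c \<bullet> z = 0"
      using descent_to_constant_cost[OF y bdd] by blast
    define p where "p = pick (tight_rows A d v)"
    have "tight_rows A d p = tight_rows A d v"
      using pick[OF v(1)] by (simp add: p_def)
    then have "(A *v (p - v)) $ i = 0" if "i \<in> tight_rows A d v" for i
      using that by (auto simp: tight_rows_def matrix_vector_mult_diff_distrib)
    then have "c \<bullet> (p - v) = 0"
      by (intro v(3)) blast
    with v(2) have "c \<bullet> p \<le> c \<bullet> y"
      by (simp add: inner_diff_right)
    moreover have "p \<in> Y"
      using v(1) by (auto simp: Y_def p_def)
    ultimately show "\<exists>v\<in>Y. c \<bullet> v \<le> c \<bullet> y"
      by blast
  qed
qed

text \<open>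
  A direction in the kernel of the tight rows and its negative are both feasible for small
  steps, so the cost vanishes on it; the double orthogonal complement of the span of the rows is the span.
\<close>

lemma minimizer_cost_in_span_tight_rows:
  fixes A :: "real^'m^'q"
  assumes y: "A *v y \<le> d" and min: "\<And>v. A *v v \<le> d \<Longrightarrow> c \<bullet> y \<le> c \<bullet> v"
  shows "c \<in> span ((\<lambda>i. row i A) ` tight_rows A d y)"
proof -
  let ?R = "(\<lambda>i. row i A) ` tight_rows A d y"
  obtain p z where p: "p \<in> span ?R" and z: "\<And>w. w \<in> span ?R \<Longrightarrow> orthogonal z w"
    and c: "c = p + z"
    using orthogonal_subspace_decomp_exists[of ?R c] by metis
  have z0: "(A *v z) $ i = 0" if "i \<in> tight_rows A d y" for i
    using z[of "row i A"] that span_base[of "row i A" ?R]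
    by (simp add: matrix_vector_mul_component row_def vec_lambda_eta orthogonal_def inner_commute)
  have "0 \<le> c \<bullet> z" "0 \<le> c \<bullet> (- z)"
    by (rule minimizer_no_descent[OF y min]; simp add: z0 matrix_vector_mult_uminus)+
  then have "c \<bullet> z = 0"
    by simp
  then have "z \<bullet> z = 0"
    using z[OF p] by (simp add: c inner_add_left orthogonal_def inner_commute[of p z])
  with p c show ?thesis
    by simp
qed

section \<open>The optimal value on a chamber\<close>

lemma feasible_y_iff: "y \<in> feasible_y A B b x \<longleftrightarrow> A *v y \<le> b - B *v x"
  by (simp add: feasible_y_def le_diff_eq)

lemma Pol_iff: "(x, y) \<in> Pol A B b \<longleftrightarrow> A *v y \<le> b - B *v x"
  by (simp add: Pol_def le_diff_eq)

lemma tight_face_of_Pol: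
  fixes A :: "real^'m^'q" and B :: "real^'n^'q"
  shows "{(x, y) \<in> Pol A B b. I \<subseteq> tight_rows A (b - B *v x) y} face_of Pol A B b"
proof -
  define h where "h i p = (A *v snd p) $ i + (B *v fst p) $ i" for i and p :: "(real^'n) \<times> (real^'m)"
  have lin: "h i ((1 - u) *\<^sub>R p + u *\<^sub>R p') = (1 - u) * h i p + u * h i p'" for i u p p'
    by (simp add: h_def matrix_vector_right_distrib matrix_vector_mult_scaleR algebra_simps)
  have P: "p \<in> Pol A B b \<longleftrightarrow> (\<forall>i. h i p \<le> b $ i)" for p
    by (cases p) (simp add: Pol_def h_def less_eq_vec_def)
  have F: "{(x, y) \<in> Pol A B b. I \<subseteq> tight_rows A (b - B *v x) y} =
      {p \<in> Pol A B b. \<forall>i\<in>I. h i p = b $ i}"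
    by (auto simp: h_def tight_rows_def eq_diff_eq)
  have conv: "(1 - u) * s + u * t \<le> k" if "0 \<le> u" "u \<le> 1" "s \<le> k" "t \<le> k" for u s t k :: real
    using convex_bound_le[of s k t "1 - u" u] that by simp
  have "convex {p \<in> Pol A B b. \<forall>i\<in>I. h i p = b $ i}"
    unfolding convex_alt by (auto simp: P lin conv) (simp add: algebra_simps)
  \<comment> \<open>A proper convex combination of two numbers \<open>\<le> k\<close> equals \<open>k\<close> only if both do.\<close>
  moreover have extremal: "s = k \<and> t = k"
    if "0 < u" "u < 1" "s \<le> k" "t \<le> k" "(1 - u) * s + u * t = k" for u s t k :: real
  proof -
    have "(1 - u) * (k - s) + u * (k - t) = 0"
      using that(5) by (simp add: algebra_simps)
    moreover have "0 \<le> (1 - u) * (k - s)" "0 \<le> u * (k - t)"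
      using that by simp_all
    ultimately have "(1 - u) * (k - s) = 0" "u * (k - t) = 0"
      by linarith+
    with that show ?thesis
      by simp
  qed
  have "h i p = b $ i \<and> h i p' = b $ i"
    if "p \<in> Pol A B b" "p' \<in> Pol A B b" and q: "q \<in> open_segment p p'" and "h i q = b $ i" for p p' q i
  proof -
    obtain u where "0 < u" "u < 1" "q = (1 - u) *\<^sub>R p + u *\<^sub>R p'"
      using q by (auto simp: in_segment)
    with that extremal[of u "h i p" "b $ i" "h i p'"] show ?thesis
      by (auto simp: lin P)
  qed
  ultimately show ?thesis
    unfolding F face_of_def by blast
qed

lemma chamber_subset_domain:
  fixes A :: "real^'m^'q" and B :: "real^'n^'q"
  assumes "x0 \<in> fst ` Pol A B b" "x \<in> chamber (Pol A B b) fst x0"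
  obtains y where "A *v y \<le> b - B *v x"
proof -
  have "Pol A B b face_of Pol A B b"
    using tight_face_of_Pol[of A B b "{}"] by simp
  then have "x \<in> fst ` Pol A B b"
    using assms unfolding chamber_def by blast
  with that show thesis
    by (auto simp: Pol_iff)
qed

lemma Vhat_eq:
  assumes "A *v y \<le> b - B *v x" "\<And>v. A *v v \<le> b - B *v x \<Longrightarrow> c \<bullet> y \<le> c \<bullet> v"
  shows "Vhat A B b x c = ereal (c \<bullet> y)"
  unfolding Vhat_def using assms by (intro lin_min_eq) (auto simp: feasible_y_iff)

lemma cost_affine_on_tight:
  fixes A :: "real^'m^'q" and B :: "real^'n^'q"
  assumes "c \<in> span ((\<lambda>i. row i A) ` I)"
  shows "\<exists>a \<beta>. \<forall>x y. I \<subseteq> tight_rows A (b - B *v x) y \<longrightarrow> c \<bullet> y = a \<bullet> x + \<beta>"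
  using assms
proof (induction rule: span_induct_alt)
  case base
  show ?case
    by (intro exI[of _ 0]) simp
next
  case (step k r c)
  then obtain i where i: "i \<in> I" "r = row i A"
    by blast
  from step obtain a \<beta> where ab: "\<forall>x y. I \<subseteq> tight_rows A (b - B *v x) y \<longrightarrow> c \<bullet> y = a \<bullet> x + \<beta>"
    by blast
  have "r \<bullet> y = b $ i - row i B \<bullet> x" if "I \<subseteq> tight_rows A (b - B *v x) y" for x y
    using that i by (auto simp: tight_rows_def matrix_vector_mul_component row_def vec_lambda_eta)
  with ab have "(k *\<^sub>R r + c) \<bullet> y = (a - k *\<^sub>R row i B) \<bullet> x + (\<beta> + k * b $ i)"
    if "I \<subseteq> tight_rows A (b - B *v x) y" for x y
    using that by (simp add: inner_add_left inner_diff_left right_diff_distrib)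
  then show ?case
    by blast
qed

text \<open>
  The tight constraints of a single minimiser over \<open>x0\<close> determine the minimisers and the optimal
  value over the whole chamber: they cut out a face whose projection contains \<open>x0\<close>, hence the
  chamber.
\<close>

lemma Vhat_affine_on_chamber:
  fixes A :: "real^'m^'q" and B :: "real^'n^'q"
  assumes x0: "x0 \<in> fst ` Pol A B b" and bdd: "\<And>v. A *v v \<le> b - B *v x0 \<Longrightarrow> k \<le> c \<bullet> v"
  shows "affine_fun_on (chamber (Pol A B b) fst x0) (\<lambda>x. Vhat A B b x c)"
proof -
  let ?d = "\<lambda>x. b - B *v x"
  obtain Y where Y: "finite Y" "\<And>v. v \<in> Y \<Longrightarrow> A *v v \<le> ?d x0"
      "\<And>y. A *v y \<le> ?d x0 \<Longrightarrow> \<exists>v\<in>Y. c \<bullet> v \<le> c \<bullet> y"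
    using finite_minimizing_set[of A "?d x0"] bdd by metis
  have "Y \<noteq> {}"
    using x0 Y(3) by (auto simp: Pol_iff)
  with \<open>finite Y\<close> obtain y0 where "y0 \<in> Y" and "\<And>v. v \<in> Y \<Longrightarrow> c \<bullet> y0 \<le> c \<bullet> v"
    using arg_min_if_finite[of Y "\<lambda>v. c \<bullet> v"] by (metis not_less)
  then have y0: "A *v y0 \<le> ?d x0" and min: "\<And>v. A *v v \<le> ?d x0 \<Longrightarrow> c \<bullet> y0 \<le> c \<bullet> v"
    using Y(2,3) by (blast, meson order_trans)
  define I where "I = tight_rows A (?d x0) y0"
  define F where "F = {(x, y) \<in> Pol A B b. I \<subseteq> tight_rows A (?d x) y}"
  have "(x0, y0) \<in> F"
    using y0 by (simp add: F_def I_def Pol_iff)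
  then have "F \<noteq> {}" "x0 \<in> fst ` F"
    by (auto intro: image_eqI[of _ _ "(x0, y0)"])
  moreover have "F face_of Pol A B b"
    unfolding F_def by (rule tight_face_of_Pol)
  ultimately have sub: "chamber (Pol A B b) fst x0 \<subseteq> fst ` F"
    unfolding chamber_def by (intro Inter_lower) blast
  obtain a \<beta> where ab: "\<And>x y. I \<subseteq> tight_rows A (?d x) y \<Longrightarrow> c \<bullet> y = a \<bullet> x + \<beta>"
    using cost_affine_on_tight[OF minimizer_cost_in_span_tight_rows[OF y0 min]]
    unfolding I_def by metis
  have "Vhat A B b x c = ereal (a \<bullet> x + \<beta>)" if x: "x \<in> chamber (Pol A B b) fst x0" for x
  proof -
    have "x \<in> fst ` F"
      using x sub by blast
    then obtain y where "(x, y) \<in> F"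
      by force
    then have y: "A *v y \<le> ?d x" and I: "I \<subseteq> tight_rows A (?d x) y"
      by (simp_all add: F_def Pol_iff)
    have "c \<bullet> y \<le> c \<bullet> v" if v: "A *v v \<le> ?d x" for v
    proof -
      have dir: "(A *v (v - y)) $ i \<le> 0" if "i \<in> tight_rows A (?d x0) y0" for i
        using that[folded I_def] I v by (auto simp: tight_rows_def less_eq_vec_def matrix_vector_mult_diff_distrib)
      have "0 \<le> c \<bullet> (v - y)"
        by (rule minimizer_no_descent[OF y0 min dir])
      then show ?thesis
        by (simp add: inner_diff_right)
    qed
    from Vhat_eq[OF y this] ab[OF I] show ?thesis
      by simp
  qed
  then show ?thesis
    unfolding affine_fun_on_def by blast
qed

section \<open>Expectation\<close>

lemma weak_duality:
  fixes A :: "real^'m^'q"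
  assumes "c \<in> uminus ` Cone (transpose A)"
  obtains u where "\<And>d v. A *v v \<le> d \<Longrightarrow> - (u \<bullet> d) \<le> c \<bullet> v"
proof -
  obtain u where u: "0 \<le> u" "c = - (transpose A *v u)"
    using assms by (auto simp: Cone_def)
  have "u \<bullet> (A *v v) \<le> u \<bullet> d" if "A *v v \<le> d" for v d
    unfolding inner_vec_def using that u(1)
    by (intro sum_mono) (auto simp: less_eq_vec_def intro: mult_left_mono)
  moreover have "c \<bullet> v = - (u \<bullet> (A *v v))" for v
    by (simp add: u(2) dot_lmul_matrix)
  ultimately show thesis
    using that[of u] by simp
qed

text \<open>
  Take points \<open>x0 + e\<close> of \<open>C\<close>, with \<open>e\<close> ranging over a basis of the span of \<open>C - x0\<close>. The value of
  an affine function at \<open>x \<in> C\<close> is a combination of its values at \<open>x0\<close> and these points, with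
  coefficients that depend on \<open>x\<close> only and therefore come out of the integral.
\<close>

lemma integral_affine_on:
  fixes g :: "'w \<Rightarrow> 'a::euclidean_space \<Rightarrow> real"
  assumes int: "\<And>x. x \<in> C \<Longrightarrow> integrable M (\<lambda>w. g w x)"
    and aff: "AE w in M. \<exists>a \<beta>. \<forall>x\<in>C. g w x = a \<bullet> x + \<beta>"
  shows "\<exists>a \<beta>. \<forall>x\<in>C. (\<integral>w. g w x \<partial>M) = a \<bullet> x + \<beta>"
proof (cases "C = {}")
  case False
  then obtain x0 where x0: "x0 \<in> C"
    by blast
  define D where "D = (\<lambda>x. x - x0) ` C"
  obtain E where E: "E \<subseteq> D" "independent E" "D \<subseteq> span E"
    using maximal_independent_subset[of D] by blast
  then have finE: "finite E"
    by (simp add: independent_imp_finite)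
  have EC: "x0 + e \<in> C" if "e \<in> E" for e
    using that E(1) by (auto simp: D_def)
  let ?I = "\<lambda>x. \<integral>w. g w x \<partial>M"
  obtain f where f: "linear f" "\<And>e. e \<in> E \<Longrightarrow> f e = ?I (x0 + e) - ?I x0"
    using linear_independent_extend[OF E(2), of "\<lambda>e. ?I (x0 + e) - ?I x0"] by blast
  have "?I x = ?I x0 + f (x - x0)" if x: "x \<in> C" for x
  proof -
    have "x - x0 \<in> span E"
      using x E(3) by (auto simp: D_def)
    then obtain r where r: "x - x0 = (\<Sum>e\<in>E. r e *\<^sub>R e)"
      by (auto simp: span_finite[OF finE])
    have "AE w in M. g w x = g w x0 + (\<Sum>e\<in>E. r e * (g w (x0 + e) - g w x0))"
      using aff
    proof (rule AE_mp, intro AE_I2 impI)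
      fix w assume "\<exists>a \<beta>. \<forall>x\<in>C. g w x = a \<bullet> x + \<beta>"
      then obtain a \<beta> where ab: "\<And>x. x \<in> C \<Longrightarrow> g w x = a \<bullet> x + \<beta>"
        by blast
      have "g w x = g w x0 + a \<bullet> (x - x0)"
        using x x0 by (simp add: ab inner_diff_right)
      also have "a \<bullet> (x - x0) = (\<Sum>e\<in>E. r e * (g w (x0 + e) - g w x0))"
        unfolding r inner_sum_right
        by (intro sum.cong) (simp_all add: ab EC x0 inner_add_right)
      finally show "g w x = g w x0 + (\<Sum>e\<in>E. r e * (g w (x0 + e) - g w x0))" .
    qed
    then have "?I x = (\<integral>w. g w x0 + (\<Sum>e\<in>E. r e * (g w (x0 + e) - g w x0)) \<partial>M)"
      by (intro integral_cong_AE) (use int x x0 EC in \<open>auto intro!: borel_measurable_integrable\<close>)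
    also have "\<dots> = ?I x0 + (\<Sum>e\<in>E. r e * (?I (x0 + e) - ?I x0))"
      using int x0 EC by simp
    also have "\<dots> = ?I x0 + f (x - x0)"
      unfolding r by (simp add: linear_sum[OF f(1)] linear_scale[OF f(1)] f(2))
    finally show ?thesis .
  qed
  moreover have "f z = adjoint f 1 \<bullet> z" for z
    using adjoint_works[OF f(1), of z 1] by (simp add: inner_commute)
  ultimately have "\<forall>x\<in>C. ?I x = adjoint f 1 \<bullet> x + (?I x0 - adjoint f 1 \<bullet> x0)"
    by (simp add: inner_diff_right)
  then show ?thesis
    by blast
qed simp

lemma ereal_expectation_eq_integral_AE:
  assumes "AE w in M. f w = ereal (g w)" "integrable M g"
  shows "ereal_expectation M f = ereal (\<integral>w. g w \<partial>M)"
proof -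
  have "(\<integral>\<^sup>+ w. e2ennreal (f w) \<partial>M) = (\<integral>\<^sup>+ w. e2ennreal (ereal (g w)) \<partial>M)"
    "(\<integral>\<^sup>+ w. e2ennreal (- f w) \<partial>M) = (\<integral>\<^sup>+ w. e2ennreal (- ereal (g w)) \<partial>M)"
    using assms(1) by (auto intro: nn_integral_cong_AE)
  then have "ereal_expectation M f = ereal_expectation M (\<lambda>w. ereal (g w))"
    unfolding ereal_expectation_def by simp
  with ereal_expectation_eq_integral[OF assms(2)] show ?thesis
    by simp
qed

text \<open>
  The equation holds at every \<open>w\<close> whose cost lies in the cone, rather than almost everywhere, so
  that the exceptional null set is common to all \<open>x\<close>; a chamber has uncountably many points.
\<close>

lemma Vhat_eq_integrable:
  fixes A :: "real^'m^'q" and B :: "real^'n^'q"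
  assumes c: "integrable M c" and y: "A *v y \<le> b - B *v x"
  shows "\<exists>g. integrable M g \<and>
           (\<forall>w. c w \<in> uminus ` Cone (transpose A) \<longrightarrow> Vhat A B b x (c w) = ereal (g w))"
proof -
  obtain Y where Y: "finite Y" "\<And>v. v \<in> Y \<Longrightarrow> A *v v \<le> b - B *v x"
    "\<And>c k y. (\<And>v. A *v v \<le> b - B *v x \<Longrightarrow> k \<le> c \<bullet> v) \<Longrightarrow> A *v y \<le> b - B *v x
       \<Longrightarrow> \<exists>v\<in>Y. c \<bullet> v \<le> c \<bullet> y"
    using finite_minimizing_set[of A "b - B *v x"] by blast
  \<comment> \<open>Any cost bounded below, such as \<open>0\<close>, shows that \<open>Y\<close> is nonempty.\<close>
  have "Y \<noteq> {}"
    using Y(3)[of 0 0 y] y by auto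
  define g where "g w = Min ((\<lambda>v. c w \<bullet> v) ` Y)" for w
  have "integrable M g"
    unfolding g_def using Y(1) \<open>Y \<noteq> {}\<close> c by (intro integrable_MIN) auto
  moreover have "Vhat A B b x (c w) = ereal (g w)" if w: "c w \<in> uminus ` Cone (transpose A)" for w
  proof -
    obtain k where bdd: "\<And>v. A *v v \<le> b - B *v x \<Longrightarrow> k \<le> c w \<bullet> v"
      by (rule weak_duality[OF w]) blast
    have "g w \<in> (\<lambda>v. c w \<bullet> v) ` Y"
      unfolding g_def using Y(1) \<open>Y \<noteq> {}\<close> by (intro Min_in) auto
    then obtain p where p: "p \<in> Y" "g w = c w \<bullet> p"
      by blast
    have "c w \<bullet> p \<le> c w \<bullet> v" if v: "A *v v \<le> b - B *v x" for v
    proof -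
      obtain q where q: "q \<in> Y" "c w \<bullet> q \<le> c w \<bullet> v"
        using Y(3)[OF bdd v] by blast
      have "g w \<le> c w \<bullet> q"
        unfolding g_def using Y(1) q(1) by (intro Min_le) auto
      with p q show ?thesis
        by simp
    qed
    from Vhat_eq[OF Y(2)[OF p(1)] this] p(2) show ?thesis
      by simp
  qed
  ultimately show ?thesis
    by blast
qed

theorem theorem11:
  fixes M :: "'w measure"
    and c :: "'w \<Rightarrow> real^'m"
    and A :: "real^'m^'q"
    and B :: "real^'n^'q"
    and b :: "real^'q"
  assumes "prob_space M"
    and "integrable M c"
    and "AE w in M. c w \<in> uminus ` Cone (transpose A)"
  shows "\<forall>C \<in> chamber_complex (Pol A B b) fst. affine_fun_on C (V M c A B b)"
proof
  fix C assume "C \<in> chamber_complex (Pol A B b) fst"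
  then obtain x0 where x0: "x0 \<in> fst ` Pol A B b" and C: "C = chamber (Pol A B b) fst x0"
    by (auto simp: chamber_complex_def)
  let ?K = "uminus ` Cone (transpose A)"
  have "\<exists>g. integrable M g \<and> (\<forall>w. c w \<in> ?K \<longrightarrow> Vhat A B b x (c w) = ereal (g w))"
    if "x \<in> C" for x
    using that chamber_subset_domain[OF x0] Vhat_eq_integrable[OF assms(2)] unfolding C by metis
  then obtain g where int: "\<And>x. x \<in> C \<Longrightarrow> integrable M (g x)"
      and g: "\<And>x w. x \<in> C \<Longrightarrow> c w \<in> ?K \<Longrightarrow> Vhat A B b x (c w) = ereal (g x w)"
    by metis
  have "\<exists>a \<beta>. \<forall>x\<in>C. g x w = a \<bullet> x + \<beta>" if w: "c w \<in> ?K" for w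
  proof -
    obtain k where "\<And>v. A *v v \<le> b - B *v x0 \<Longrightarrow> k \<le> c w \<bullet> v"
      by (rule weak_duality[OF w]) blast
    then have "affine_fun_on C (\<lambda>x. Vhat A B b x (c w))"
      unfolding C by (rule Vhat_affine_on_chamber[OF x0])
    then show ?thesis
      by (auto simp: affine_fun_on_def g w)
  qed
  then have "\<exists>a \<beta>. \<forall>x\<in>C. (\<integral>w. g x w \<partial>M) = a \<bullet> x + \<beta>"
    using int assms(3) by (intro integral_affine_on) auto
  then obtain a \<beta> where ab: "\<And>x. x \<in> C \<Longrightarrow> (\<integral>w. g x w \<partial>M) = a \<bullet> x + \<beta>"
    by blast
  have "V M c A B b x = ereal (a \<bullet> x + \<beta>)" if x: "x \<in> C" for x
  proof -
    have "AE w in M. Vhat A B b x (c w) = ereal (g x w)"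
      using assms(3) by (rule AE_mp) (simp add: g x)
    from ereal_expectation_eq_integral_AE[OF this int[OF x]] show ?thesis
      by (simp add: V_def ab x)
  qed
  then show "affine_fun_on C (V M c A B b)"
    unfolding affine_fun_on_def by blast
qed

end
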